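(* Let $K:(0,\infty)\to\mathbb{R}$ be $C^1$ and strictly decreasing with $\int_0^1 K(r)\,r\,dr<\infty$, and let $D(\Omega)=\int_\Omega\int_\Omega K(|x-y|)\,dx\,dy$. Fix an area $m>0$, and for $q\ge1$ let $R_q\subset\mathbb{R}^2$ be the rectangle (unique up to congruence) of area $m$ such that $q$ is the ratio of its length to its width. Then $q\mapsto D(R_q)$ is a strictly decreasing function for $q\ge1$.
   Context: $D$ is invariant under rigid motions, so $D(R_q)$ is well defined; the condition $\int_0^1K(r)r\,dr<\infty$ guarantees that $D$ is finite on bounded planar domains. *)

theory Defs
  imports "HOL-Analysis.Analysis"
begin

(* The value of K at 0 is irrelevant: for each x it only enters at y = x, a null set. *)
definition double_integral :: "(real \<Rightarrow> real) \<Rightarrow> (real^2) set \<Rightarrow> real" where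
  "double_integral K \<Omega> = (LINT x:\<Omega>|lborel. LINT y:\<Omega>|lborel. K (dist x y))"

(* A rectangle in arbitrary position: c is a corner, the orthonormal vectors u and v are
   the directions of the sides of lengths l and w. *)
definition rectangle :: "real \<Rightarrow> real \<Rightarrow> (real^2) set \<Rightarrow> bool" where
  "rectangle l w R \<longleftrightarrow> 0 < l \<and> 0 < w \<and>
     (\<exists>c u v. norm u = 1 \<and> norm v = 1 \<and> u \<bullet> v = 0 \<and>
        R = {c + s *\<^sub>R u + t *\<^sub>R v | s t. 0 \<le> s \<and> s \<le> l \<and> 0 \<le> t \<and> t \<le> w})"

definition rectangle_of_area_and_ratio :: "real \<Rightarrow> real \<Rightarrow> (real^2) set \<Rightarrow> bool" where
  "rectangle_of_area_and_ratio m q R \<longleftrightarrow>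
     measure lborel R = m \<and> (\<exists>l w. rectangle l w R \<and> q = l / w)"

end

theory Submission
  imports Defs
begin

text \<open>
  In coordinates along its sides, the rectangle with sides \<open>l, w\<close> has energy
  \<open>\<integral> (l - |s|)\<^sub>+ (w - |t|)\<^sub>+ K(|(s, t)|)\<close>, the integral of \<open>K\<close> against the area of the intersection
  of the rectangle with its translate by \<open>(s, t)\<close>. Keep \<open>l w = m\<close> fixed and increase \<open>l\<close>: the
  derivative of the energy is the integral of \<open>(w/l |s| - |t|) K(|(s, t)|)\<close> over \<open>|s| < l, |t| < w\<close>.
  The area-preserving involution \<open>(s, t) \<mapsto> (l/w t, w/l s)\<close> preserves this domain and flips the sign of
  the first factor; for \<open>l > w\<close> it shortens exactly the vectors where that factor is positive. As
  \<open>K\<close> is strictly decreasing, each pair of points exchanged by the involution contributes a negative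
  amount. Integrating the derivative over \<open>l\<close> and applying Fubini compares two energies.
\<close>

subsection \<open>Lebesgue measure in orthonormal coordinates\<close>

lemma prod_Basis_real_pair: "(\<Prod>b\<in>(Basis :: (real \<times> real) set). f b) = f (1, 0) * f (0, 1)"
  by (simp add: Basis_prod_def mult.commute)

lemma emeasure_lborel_box_pair:
  fixes a b :: "real \<times> real"
  assumes "fst a \<le> fst b" "snd a \<le> snd b"
  shows "emeasure lborel (box a b) = ennreal ((fst b - fst a) * (snd b - snd a))"
  using assms by (subst emeasure_lborel_box) (auto simp: Basis_prod_def inner_prod_def mult.commute)

lemma borel_measurable_vector_2 [measurable]:
  "(\<lambda>p :: real \<times> real. vector [fst p, snd p] :: real^2) \<in> borel_measurable borel"
proof -
  have eq: "(\<lambda>p :: real \<times> real. vector [fst p, snd p] :: real^2) = (\<lambda>p. fst p *\<^sub>R axis 1 1 + snd p *\<^sub>R axis 2 1)"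
    by (auto simp: vec_eq_iff forall_2 axis_def)
  show ?thesis
    unfolding eq by (intro borel_measurable_continuous_onI continuous_intros)
qed

text \<open>Identifying pairs with vectors of \<open>real^2\<close> carries boxes to boxes of the
  same area, and boxes determine Lebesgue measure.\<close>

lemma distr_lborel_vector_2: "distr lborel borel (\<lambda>p :: real \<times> real. vector [fst p, snd p] :: real^2) = lborel"
proof (rule lborel_eqI[symmetric])
  fix l u :: "real^2" assume le: "\<And>b. b \<in> Basis \<Longrightarrow> l \<bullet> b \<le> u \<bullet> b"
  have le': "l $ 1 \<le> u $ 1" "l $ 2 \<le> u $ 2"
    using le[of "axis 1 1"] le[of "axis 2 1"] by (auto simp: Basis_vec_def inner_axis)
  have vimage: "(\<lambda>p. vector [fst p, snd p]) -` box l u = box (l $ 1, l $ 2) (u $ 1, u $ 2)"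
    by (rule set_eqI) (auto simp: mem_box_cart forall_2 mem_box(1)[of "_ :: real \<times> real"] Basis_prod_def inner_prod_def)
  have "(\<Prod>b\<in>Basis. (u - l) \<bullet> b) = (u $ 1 - l $ 1) * (u $ 2 - l $ 2)"
    by (simp add: Basis_vec_def UNIV_2 inner_axis axis_eq_axis)
  then show "emeasure (distr lborel borel (\<lambda>p. vector [fst p, snd p])) (box l u) = (\<Prod>b\<in>Basis. (u - l) \<bullet> b)"
    using le' by (simp add: emeasure_distr vimage emeasure_lborel_box_pair)
qed simp

text \<open>The preimage of a box is its image under the inverse, which is again orthogonal and
  therefore preserves volume.\<close>

lemma distr_lborel_orthogonal:
  fixes T :: "real^'n::{finite,wellorder} \<Rightarrow> real^'n::_"
  assumes T: "orthogonal_transformation T"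
  shows "distr lborel borel T = lborel"
proof (rule lborel_eqI[symmetric])
  have [measurable]: "T \<in> borel_measurable borel"
    using T by (intro borel_measurable_continuous_onI)
      (simp add: linear_continuous_on linear_linear orthogonal_transformation_linear)
  fix l u :: "real^'n::_" assume le: "\<And>b. b \<in> Basis \<Longrightarrow> l \<bullet> b \<le> u \<bullet> b"
  have inv: "orthogonal_transformation (inv T)"
    using T by (rule orthogonal_transformation_inv)
  have eq: "T -` box l u = inv T ` box l u"
    using T by (simp add: bij_vimage_eq_inv_image orthogonal_transformation_bij)
  have "box l u \<in> lmeasurable" by simp
  then have "emeasure lebesgue (inv T ` box l u) = emeasure lebesgue (box l u)"
    using measure_orthogonal_image[OF inv, of "box l u"] measurable_orthogonal_image[OF inv, of "box l u"]
    by (metis emeasure_eq_measure2)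
  moreover have "T -` box l u \<in> sets borel"
    using measurable_sets[of T borel borel "box l u"] by simp
  ultimately have "emeasure lborel (T -` box l u) = emeasure lborel (box l u)"
    by (simp add: eq)
  then show "emeasure (distr lborel borel T) (box l u) = (\<Prod>b\<in>Basis. (u - l) \<bullet> b)"
    using le by (simp add: emeasure_distr)
qed simp

text \<open>Coordinates are pairs because \<open>lborel\<close> on pairs is a product measure, so
  contents of boxes and iterated integrals are available coordinatewise.\<close>

definition frame :: "real^2 \<Rightarrow> real^2 \<Rightarrow> real^2 \<Rightarrow> real \<times> real \<Rightarrow> real^2" where
  "frame c u v p = c + fst p *\<^sub>R u + snd p *\<^sub>R v"

lemma measurable_frame [measurable]: "frame c u v \<in> borel_measurable borel"
  unfolding frame_def by (intro borel_measurable_continuous_onI continuous_intros)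

lemma dist_frame:
  assumes "norm u = 1" "norm v = 1" "u \<bullet> v = 0"
  shows "dist (frame c u v p) (frame c u v p') = norm (p' - p)"
proof -
  define s t where "s = fst p' - fst p" and "t = snd p' - snd p"
  have uv: "u \<bullet> u = 1" "v \<bullet> v = 1" "v \<bullet> u = 0"
    using assms by (simp_all add: norm_eq_1 inner_commute)
  have "frame c u v p' - frame c u v p = s *\<^sub>R u + t *\<^sub>R v"
    by (simp add: frame_def s_def t_def algebra_simps)
  then have "(dist (frame c u v p) (frame c u v p'))\<^sup>2 = (s *\<^sub>R u + t *\<^sub>R v) \<bullet> (s *\<^sub>R u + t *\<^sub>R v)"
    by (simp add: dist_norm norm_minus_commute[of "frame c u v p"] power2_norm_eq_inner)
  also have "\<dots> = s\<^sup>2 + t\<^sup>2"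
    using assms by (simp add: inner_simps uv power2_eq_square)
  also have "\<dots> = (norm (p' - p))\<^sup>2"
    by (simp add: norm_prod_def s_def t_def)
  finally show ?thesis by simp
qed

lemma inj_frame:
  assumes "norm u = 1" "norm v = 1" "u \<bullet> v = 0"
  shows "inj (frame c u v)"
proof (rule injI)
  fix p p' assume "frame c u v p = frame c u v p'"
  then show "p = p'"
    using dist_frame[OF assms, of c p p'] by simp
qed

text \<open>The frame map factors into the identification of pairs with vectors, the orthogonal map
  sending the standard basis to \<open>u\<close>, \<open>v\<close>, and the translation by
  \<open>c\<close>; each preserves Lebesgue measure.\<close>

lemma distr_lborel_frame:
  assumes "norm u = 1" "norm v = 1" "u \<bullet> v = 0"
  shows "distr lborel borel (frame c u v) = lborel"
proof -
  define T :: "real^2 \<Rightarrow> real^2" where "T x = x $ 1 *\<^sub>R u + x $ 2 *\<^sub>R v" for x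
  have uv: "u \<bullet> u = 1" "v \<bullet> v = 1" "v \<bullet> u = 0"
    using assms by (simp_all add: norm_eq_1 inner_commute)
  have lin: "linear T"
    by (auto simp: T_def linear_iff algebra_simps)
  have "norm (T x) = norm x" for x
  proof -
    have "T x \<bullet> T x = x $ 1 * x $ 1 + x $ 2 * x $ 2"
      by (simp add: T_def inner_simps uv assms)
    then show ?thesis
      by (simp add: norm_eq_sqrt_inner inner_vec_def sum_2)
  qed
  with lin have T: "orthogonal_transformation T"
    by (simp add: orthogonal_transformation)
  have [measurable]: "T \<in> borel_measurable borel"
    using lin by (intro borel_measurable_continuous_onI) (simp add: linear_continuous_on linear_linear)
  have "frame c u v = (+) c \<circ> (T \<circ> (\<lambda>p. vector [fst p, snd p]))"
    by (auto simp: frame_def T_def fun_eq_iff)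
  then have "distr lborel borel (frame c u v) =
      distr (distr (distr lborel borel (\<lambda>p. vector [fst p, snd p])) borel T) borel ((+) c)"
    by (simp add: distr_distr)
  then show ?thesis
    by (simp add: distr_lborel_vector_2 distr_lborel_orthogonal[OF T] lborel_distr_plus)
qed

subsection \<open>Reduction to the overlap of translates\<close>

lemma set_lebesgue_integral_frame:
  fixes g :: "real^2 \<Rightarrow> real"
  assumes uv: "norm u = 1" "norm v = 1" "u \<bullet> v = 0"
    and A: "compact A" and [measurable]: "g \<in> borel_measurable borel"
  shows "(LINT x:frame c u v ` A|lborel. g x) = (LINT p:A|lborel. g (frame c u v p))"
proof -
  have "continuous_on A (frame c u v)"
    unfolding frame_def by (intro continuous_intros)
  then have [measurable]: "frame c u v ` A \<in> sets borel"
    using A by (intro borel_compact compact_continuous_image)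
  have "(LINT x:frame c u v ` A|lborel. g x)
      = (\<integral>x. indicator (frame c u v ` A) x *\<^sub>R g x \<partial>distr lborel borel (frame c u v))"
    by (simp add: set_lebesgue_integral_def distr_lborel_frame[OF uv])
  also have "\<dots> = (\<integral>p. indicator (frame c u v ` A) (frame c u v p) *\<^sub>R g (frame c u v p) \<partial>lborel)"
    by (rule integral_distr) simp_all
  also have "\<dots> = (LINT p:A|lborel. g (frame c u v p))"
    by (simp add: set_lebesgue_integral_def indicator_def inj_image_mem_iff[OF inj_frame[OF uv]])
  finally show ?thesis .
qed

lemma (in pair_sigma_finite) integrable_product_mult:
  fixes f :: "'a \<Rightarrow> real" and g :: "'b \<Rightarrow> real"
  assumes [measurable]: "integrable M1 f" "integrable M2 g"
  shows "integrable (M1 \<Otimes>\<^sub>M M2) (\<lambda>(x, y). f x * g y)"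
proof (rule Fubini_integrable)
  show "integrable M1 (\<lambda>x. \<integral>y. norm (case (x, y) of (x, y) \<Rightarrow> f x * g y) \<partial>M2)"
    using assms by (simp add: abs_mult)
  show "AE x in M1. integrable M2 (\<lambda>y. case (x, y) of (x, y) \<Rightarrow> f x * g y)"
    using assms by simp
qed measurable

lemma integrable_indicator_cbox: "integrable lborel (indicator (cbox a b) :: 'a::euclidean_space \<Rightarrow> real)"
  by (rule integrable_real_indicator) (simp_all add: emeasure_lborel_cbox_finite[simplified])

text \<open>The covariogram of the box with sides \<open>l\<close>, \<open>w\<close>. The
  truncations at 0 make it vanish once a shift exceeds the corresponding side.\<close>

definition overlap :: "real \<Rightarrow> real \<Rightarrow> real \<times> real \<Rightarrow> real" where
  "overlap l w z = max 0 (l - \<bar>fst z\<bar>) * max 0 (w - \<bar>snd z\<bar>)"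

lemma integral_indicator_translate:
  assumes "0 < l" "0 < w"
  shows "(\<integral>p. indicator (cbox (0, 0) (l, w)) p * indicator (cbox (0, 0) (l, w)) (p + z) \<partial>lborel)
    = overlap l w z"
proof -
  define s t where "s = fst z" and "t = snd z"
  have [simp]: "z = (s, t)" by (simp add: s_def t_def)
  \<comment> \<open>In each coordinate the two membership conditions cut out a single interval, of
    length \<open>l - \<bar>s\<bar>\<close> or \<open>w - \<bar>t\<bar>\<close>, or empty when that
    number is negative.\<close>
  let ?B = "cbox (max 0 (- s), max 0 (- t)) (min l (l - s), min w (w - t))"
  have "(\<lambda>p. indicator (cbox (0, 0) (l, w)) p * indicator (cbox (0, 0) (l, w)) (p + z) :: real) = indicator ?B"
    by (auto simp: indicator_def fun_eq_iff)
  then have "(\<integral>p. indicator (cbox (0, 0) (l, w)) p * indicator (cbox (0, 0) (l, w)) (p + z) \<partial>lborel) = measure lborel ?B"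
    by simp
  also have "\<dots> = overlap l w z"
    unfolding content_Pair overlap_def using assms
    by (intro arg_cong2[where f="(*)"]) (auto simp: content_real_if)
  finally show ?thesis .
qed

lemma double_integral_frame:
  assumes uv: "norm u = 1" "norm v = 1" "u \<bullet> v = 0" and lw: "0 < l" "0 < w"
    and [measurable]: "K \<in> borel_measurable borel"
    and int: "set_integrable lborel (cbox (- l, - w) (l, w)) (\<lambda>z. K (norm z))"
  shows "double_integral K (frame c u v ` cbox (0, 0) (l, w)) = (\<integral>z. overlap l w z * K (norm z) \<partial>lborel)"
proof -
  let ?Q = "cbox (0, 0) (l, w)" and ?B = "cbox (- l, - w) (l, w)"
  let ?R = "frame c u v ` ?Q"
  let ?f = "\<lambda>p z. indicator ?Q p * (indicator ?Q (p + z) * K (norm z)) :: real"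
  have meas: "(\<lambda>x. LINT y:?R|lborel. K (dist x y)) \<in> borel_measurable borel"
  proof -
    have "continuous_on ?Q (frame c u v)"
      unfolding frame_def by (intro continuous_intros)
    then have [measurable]: "?R \<in> sets borel"
      by (intro borel_compact compact_continuous_image compact_cbox)
    show ?thesis
      unfolding set_lebesgue_integral_def by measurable
  qed
  have translate: "(LINT p':?Q|lborel. K (norm (p' - p))) = (\<integral>z. indicator ?Q (p + z) * K (norm z) \<partial>lborel)" for p
  proof -
    have "(LINT p':?Q|lborel. K (norm (p' - p)))
        = (\<integral>p'. indicator ?Q p' * K (norm (p' - p)) \<partial>distr lborel borel ((+) p))"
      by (simp add: set_lebesgue_integral_def lborel_distr_plus)
    also have "\<dots> = (\<integral>z. indicator ?Q (p + z) * K (norm ((p + z) - p)) \<partial>lborel)"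
      by (rule integral_distr) simp_all
    finally show ?thesis by simp
  qed
  have "double_integral K ?R = (LINT p:?Q|lborel. LINT p':?Q|lborel. K (norm (p' - p)))"
    unfolding double_integral_def set_lebesgue_integral_frame[OF uv compact_cbox meas]
    by (simp add: set_lebesgue_integral_frame[OF uv compact_cbox] dist_frame[OF uv])
  also have "\<dots> = (\<integral>p. \<integral>z. ?f p z \<partial>lborel \<partial>lborel)"
    unfolding translate by (simp add: set_lebesgue_integral_def)
  also have "\<dots> = (\<integral>z. \<integral>p. ?f p z \<partial>lborel \<partial>lborel)"
  proof (rule lborel_pair.Fubini_integral[symmetric])
    \<comment> \<open>Two points of \<open>?Q\<close> differ by a vector of \<open>?B\<close>, so
      this product of a function of \<open>p\<close> and a function of \<open>z\<close> dominates
      the integrand and justifies Fubini.\<close>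
    have "integrable (lborel \<Otimes>\<^sub>M lborel) (\<lambda>(p, z). indicator ?Q p * (indicator ?B z * K (norm z)) :: real)"
      using int by (intro lborel_pair.integrable_product_mult)
        (simp_all add: set_integrable_def integrable_indicator_cbox)
    moreover have "\<bar>?f p z\<bar> \<le> \<bar>indicator ?Q p * (indicator ?B z * K (norm z))\<bar>" for p z
      by (cases p; cases z) (auto simp: indicator_def)
    ultimately show "integrable (lborel \<Otimes>\<^sub>M lborel) (\<lambda>(p, z). ?f p z)"
      by (elim Bochner_Integration.integrable_bound) (auto simp: case_prod_unfold)
  qed
  also have "\<dots> = (\<integral>z. overlap l w z * K (norm z) \<partial>lborel)"
    by (simp add: integral_indicator_translate[OF lw, symmetric] mult.assoc flip: integral_mult_left_zero)
  finally show ?thesis .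
qed

section \<open>Integrability of the radial kernel on bounded boxes\<close>

lemma integrable_even_extension:
  fixes f :: "real \<Rightarrow> real"
  assumes "set_integrable lborel {0<..a} f"
  shows "integrable lborel (\<lambda>s. indicator {0<..a} \<bar>s\<bar> * f \<bar>s\<bar>)"
proof -
  have f: "integrable lborel (\<lambda>s. indicator {0<..a} s * f s)"
    using assms by (simp add: set_integrable_def)
  have "integrable lborel (\<lambda>s. indicator {0<..a} s * f s + indicator {0<..a} (- s) * f (- s))"
    using f lborel_integrable_real_affine[OF f, of "-1" 0] by simp
  then show ?thesis
    by (rule Bochner_Integration.integrable_cong[THEN iffD1, rotated 2]) (auto simp: indicator_def abs_if)
qed

text \<open>Since the Euclidean norm dominates the maximum norm, K at the Euclidean norm is at most K at the
  maximum norm, whose planar integral reduces to that of \<open>K r * r\<close> without polar coordinates.\<close>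

lemma set_integrable_radial:
  fixes K :: "real \<Rightarrow> real" and a b :: "real \<times> real"
  assumes [measurable]: "K \<in> borel_measurable borel" and mono: "antimono_on {0<..} K"
    and int: "set_integrable lborel {0<..1} (\<lambda>r. K r * r)"
  shows "set_integrable lborel (cbox a b) (\<lambda>z. K (norm z))"
proof -
  \<comment> \<open>\<open>g\<close> lives on the part of the plane where
    \<open>\<bar>s\<bar>\<close> is the maximum norm; exchanging the coordinates covers the rest.
    Integrating out \<open>t\<close> gives the factor \<open>2 * \<bar>s\<bar>\<close>, the source
    of the weight \<open>r\<close> in the hypothesis.\<close>
  define g :: "real \<times> real \<Rightarrow> real"
    where "g = (\<lambda>(s, t). indicator {0<..1} \<bar>s\<bar> * indicator {- \<bar>s\<bar>..\<bar>s\<bar>} t * \<bar>K \<bar>s\<bar>\<bar>)"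
  have [measurable]: "g \<in> borel_measurable (lborel \<Otimes>\<^sub>M lborel)"
  proof -
    have "g = (\<lambda>p. indicator {0<..1} \<bar>fst p\<bar> * indicator {p. \<bar>snd p\<bar> \<le> \<bar>fst p\<bar>} p * \<bar>K \<bar>fst p\<bar>\<bar>)"
      by (auto simp: g_def indicator_def fun_eq_iff abs_le_iff)
    then show ?thesis by simp
  qed
  have g: "integrable (lborel \<Otimes>\<^sub>M lborel) g"
  proof (rule lborel_pair.Fubini_integrable)
    have eq: "(\<integral>t. norm (g (s, t)) \<partial>lborel) = 2 * \<bar>indicator {0<..1} \<bar>s\<bar> * (K \<bar>s\<bar> * \<bar>s\<bar>)\<bar>" for s
      by (simp add: g_def abs_mult)
    show "integrable lborel (\<lambda>s. \<integral>t. norm (g (s, t)) \<partial>lborel)"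
      unfolding eq using integrable_even_extension[OF int] by (intro integrable_mult_right integrable_abs)
    show "AE s in lborel. integrable lborel (\<lambda>t. g (s, t))"
      by (auto simp: g_def)
  qed measurable
  have g': "integrable lborel (\<lambda>z. g z + g (snd z, fst z))"
    using g lborel_pair.integrable_product_swap[OF g] by (simp add: lborel_prod case_prod_unfold)
  obtain c where c: "\<And>z. z \<in> cbox a b \<Longrightarrow> norm z \<le> c" "1 \<le> c"
    using bounded_cbox[of a b] by (metis bounded_pos le_max_iff_disj max.cobounded2 max.commute)
  \<comment> \<open>\<open>K 0\<close> serves the origin, \<open>K c\<close> bounds from below on
    the rest of the box, and \<open>K 1\<close> from above where the maximum norm is at least 1.
    Closer to the origin the upper bound comes from \<open>g\<close>.\<close>
  define C where "C = \<bar>K 0\<bar> + \<bar>K 1\<bar> + \<bar>K c\<bar>"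
  have bound: "\<bar>K (norm z)\<bar> \<le> C + (g z + g (snd z, fst z))" if "z \<in> cbox a b" for z
  proof -
    define r where "r = max \<bar>fst z\<bar> \<bar>snd z\<bar>"
    have r: "r \<le> norm z"
      by (cases z) (simp add: r_def norm_Pair real_sqrt_sum_squares_ge1 real_sqrt_sum_squares_ge2)
    have pos: "0 \<le> g z" for z
      by (simp add: g_def case_prod_unfold)
    consider "z = 0" | "1 \<le> r" | "0 < r" "r < 1"
      by (force simp: r_def prod_eq_iff)
    then show ?thesis
    proof cases
      case 1
      then show ?thesis using pos[of z] pos[of "(snd z, fst z)"] by (simp add: C_def)
    next
      case 2
      then have "K c \<le> K (norm z)" "K (norm z) \<le> K 1"
        using c(1)[OF that] c(2) r by (auto intro!: monotone_onD[OF mono])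
      then show ?thesis using pos[of z] pos[of "(snd z, fst z)"] by (simp add: C_def)
    next
      case 3
      then have "K c \<le> K (norm z)" "K (norm z) \<le> K r"
        using c(1)[OF that] c(2) r by (auto intro!: monotone_onD[OF mono])
      moreover have "\<bar>K r\<bar> \<le> g z + g (snd z, fst z)"
      proof (cases "\<bar>snd z\<bar> \<le> \<bar>fst z\<bar>")
        case True
        then have "g z = \<bar>K r\<bar>"
          using 3 by (auto simp: g_def r_def case_prod_unfold indicator_def)
        then show ?thesis using pos[of "(snd z, fst z)"] by simp
      next
        case False
        then have "g (snd z, fst z) = \<bar>K r\<bar>"
          using 3 by (auto simp: g_def r_def case_prod_unfold indicator_def)
        then show ?thesis using pos[of z] by simp
      qed
      ultimately show ?thesis by (simp add: C_def)
    qed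
  qed
  have "set_integrable lborel (cbox a b) (\<lambda>z. C + (g z + g (snd z, fst z)))"
  proof (rule set_integral_add)
    show "set_integrable lborel (cbox a b) (\<lambda>z. C)"
      by (simp add: set_integrable_def integrable_indicator_cbox)
    show "set_integrable lborel (cbox a b) (\<lambda>z. g z + g (snd z, fst z))"
      unfolding set_integrable_def using g' by (rule integrable_mult_indicator[rotated]) simp
  qed
  then show ?thesis
    unfolding set_integrable_def
    by (rule Bochner_Integration.integrable_bound) (auto simp: indicator_def dest!: bound)
qed

subsection \<open>Variation of the sides at constant area\<close>

text \<open>Away from the boundary of the support, this is the derivative of \<^term>\<open>overlap x (m / x) z\<close>
  with respect to \<open>x\<close> at \<open>x = l\<close>, where \<open>w = m / l\<close>.\<close>

definition overlap_rate :: "real \<Rightarrow> real \<Rightarrow> real \<times> real \<Rightarrow> real" where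
  "overlap_rate l w z = (if \<bar>fst z\<bar> < l \<and> \<bar>snd z\<bar> < w then w / l * \<bar>fst z\<bar> - \<bar>snd z\<bar> else 0)"

text \<open>As a function of \<open>x\<close> the overlap is continuous with kinks only where one of
  its two factors reaches 0, so the fundamental theorem of calculus applies with a finite
  exceptional set.\<close>

lemma has_integral_overlap_rate:
  assumes "0 < m" "0 < a" "a \<le> b"
  shows "((\<lambda>x. overlap_rate x (m / x) z) has_integral overlap b (m / b) z - overlap a (m / a) z) {a..b}"
proof -
  define s t where "s = \<bar>fst z\<bar>" and "t = \<bar>snd z\<bar>"
  have [simp]: "0 \<le> s" "0 \<le> t" by (simp_all add: s_def t_def)
  have overlap: "overlap x (m / x) z = max 0 (x - s) * max 0 (m / x - t)" for x
    by (simp add: overlap_def s_def t_def)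
  have rate: "overlap_rate x (m / x) z = (if s < x \<and> t < m / x then m / x / x * s - t else 0)" for x
    by (simp add: overlap_rate_def s_def t_def)
  show ?thesis
  proof (rule fundamental_theorem_of_calculus_interior_strong)
    \<comment> \<open>For \<open>t = 0\<close> the second point is \<open>m / 0 = 0\<close>, which
      lies outside \<open>{a..b}\<close>; the second factor has no kink then.\<close>
    show "finite {s, m / t}" by simp
    show "continuous_on {a..b} (\<lambda>x. overlap x (m / x) z)"
      unfolding overlap using assms by (intro continuous_intros) auto
    fix x assume x: "x \<in> {a<..<b} - {s, m / t}"
    then have "0 < x" using assms by auto
    consider "x < s" | "s < x" "t * x < m" | "s < x" "m < t * x"
      using x assms by (cases "t = 0") (auto simp: field_simps not_less intro: linorder_cases)
    then have "((\<lambda>x. max 0 (x - s) * max 0 (m / x - t)) has_real_derivative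
        overlap_rate x (m / x) z) (at x)"
    proof cases
      case 1
      have "((\<lambda>x. 0) has_real_derivative overlap_rate x (m / x) z) (at x)"
        using 1 by (simp add: rate)
      then show ?thesis
        by (rule has_field_derivative_transform_within_open[where S="{..<s}"]) (use 1 in auto)
    next
      case 2
      have "((\<lambda>x. (x - s) * (m / x - t)) has_real_derivative overlap_rate x (m / x) z) (at x)"
        using 2 \<open>0 < x\<close> by (auto simp: rate field_simps intro!: derivative_eq_intros)
      moreover have "open ({s<..} \<inter> {0<..} \<inter> {y. t * y < m})"
        by (intro open_Int open_greaterThan open_Collect_less continuous_intros)
      ultimately show ?thesis
        by (rule has_field_derivative_transform_within_open) (use 2 \<open>0 < x\<close> in \<open>auto simp: field_simps\<close>)
    next
      case 3
      have "((\<lambda>x. 0) has_real_derivative overlap_rate x (m / x) z) (at x)"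
        using 3 \<open>0 < x\<close> by (auto simp add: rate field_simps)
      moreover have "open ({0<..} \<inter> {y. m < t * y})"
        by (intro open_Int open_greaterThan open_Collect_less continuous_intros)
      ultimately show ?thesis
        by (rule has_field_derivative_transform_within_open) (use 3 \<open>0 < x\<close> in \<open>auto simp: field_simps\<close>)
    qed
    then show "((\<lambda>x. overlap x (m / x) z) has_vector_derivative overlap_rate x (m / x) z) (at x)"
      by (simp add: overlap has_real_derivative_iff_has_vector_derivative)
  qed fact
qed

text \<open>Where the rate is not set to 0, both of its terms lie between 0 and
  \<open>w\<close>.\<close>

lemma abs_overlap_rate_le:
  assumes "0 < l" "0 < w"
  shows "\<bar>overlap_rate l w z\<bar> \<le> w"
proof -
  have "w / l * \<bar>fst z\<bar> \<le> w" if "\<bar>fst z\<bar> < l"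
  proof -
    have "w / l * \<bar>fst z\<bar> \<le> w / l * l"
      using assms that by (intro mult_left_mono) auto
    then show ?thesis using assms by simp
  qed
  moreover obtain r where r: "r = w / l * \<bar>fst z\<bar>" by simp
  moreover have "0 \<le> r" using assms by (simp add: r)
  ultimately show ?thesis
    unfolding overlap_rate_def r[symmetric] using assms by (auto simp: abs_le_iff)
qed

lemma borel_measurable_overlap_rate [measurable]:
  assumes [measurable]: "f \<in> borel_measurable M" "g \<in> borel_measurable M" "h \<in> borel_measurable M"
  shows "(\<lambda>x. overlap_rate (f x) (g x) (h x)) \<in> borel_measurable M"
proof -
  have [measurable]: "(\<lambda>x. fst (h x)) \<in> borel_measurable M" "(\<lambda>x. snd (h x)) \<in> borel_measurable M"
    by (auto intro!: borel_measurable_continuous_on[OF _ assms(3)] continuous_intros)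
  show ?thesis unfolding overlap_rate_def by measurable
qed

section \<open>Sign of the derivative by pairing points\<close>

lemma integral_neg:
  fixes f :: "'a \<Rightarrow> real"
  assumes f: "integrable M f" and le: "AE x in M. f x \<le> 0"
    and A: "A \<in> sets M" "emeasure M A \<noteq> 0" and less: "\<And>x. x \<in> A \<Longrightarrow> f x < 0"
  shows "integral\<^sup>L M f < 0"
proof (rule ccontr)
  assume "\<not> integral\<^sup>L M f < 0"
  moreover have "0 \<le> (\<integral>x. - f x \<partial>M)"
    using le by (intro integral_nonneg_AE) auto
  ultimately have "(\<integral>x. - f x \<partial>M) = 0" by simp
  then have "AE x in M. - f x = 0"
    using f le by (subst (asm) integral_nonneg_eq_0_iff_AE) auto
  then have "AE x in M. x \<notin> A"
    by eventually_elim (use less in force)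
  with A show False
    by (simp add: AE_iff_null_sets[symmetric] null_sets_def)
qed

text \<open>With coordinates measured in units of the sides, \<open>z = (l * x, w * y)\<close>, this
  is the reflection exchanging \<open>x\<close> and \<open>y\<close>. It has determinant -1 and
  preserves the box.\<close>

definition aspect_swap :: "real \<Rightarrow> real \<Rightarrow> real \<times> real \<Rightarrow> real \<times> real" where
  "aspect_swap l w z = (l / w * snd z, w / l * fst z)"

lemma measurable_aspect_swap [measurable]: "aspect_swap l w \<in> borel_measurable borel"
  unfolding aspect_swap_def by (intro borel_measurable_continuous_onI continuous_intros)

lemma distr_lborel_aspect_swap:
  assumes "0 < l" "0 < w"
  shows "distr lborel borel (aspect_swap l w) = lborel"
proof (rule lborel_eqI[symmetric])
  fix a b :: "real \<times> real" assume le: "\<And>i. i \<in> Basis \<Longrightarrow> a \<bullet> i \<le> b \<bullet> i"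
  have le': "fst a \<le> fst b" "snd a \<le> snd b"
    using le[of "(1, 0)"] le[of "(0, 1)"] by (auto simp: Basis_prod_def inner_prod_def)
  have vimage: "aspect_swap l w -` box a b
      = box (l / w * snd a, w / l * fst a) (l / w * snd b, w / l * fst b)"
    using assms by (auto simp: aspect_swap_def mem_box(1) Basis_prod_def inner_prod_def field_simps)
  have "(l / w * snd b - l / w * snd a) * (w / l * fst b - w / l * fst a) = (fst b - fst a) * (snd b - snd a)"
    using assms by (simp add: field_simps)
  moreover have "(\<Prod>i\<in>Basis. (b - a) \<bullet> i) = (fst b - fst a) * (snd b - snd a)"
    by (simp add: prod_Basis_real_pair inner_prod_def)
  ultimately show "emeasure (distr lborel borel (aspect_swap l w)) (box a b) = (\<Prod>i\<in>Basis. (b - a) \<bullet> i)"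
    using le' assms by (simp add: emeasure_distr vimage emeasure_lborel_box_pair divide_right_mono mult_left_mono)
qed simp

text \<open>In units of the sides the rate is \<open>w * (\<bar>x\<bar> - \<bar>y\<bar>)\<close>
  inside the box, which is antisymmetric in \<open>x\<close> and \<open>y\<close>.\<close>

lemma overlap_rate_aspect_swap:
  assumes "0 < l" "0 < w"
  shows "overlap_rate l w (aspect_swap l w z) = - overlap_rate l w z"
proof -
  have "\<bar>l / w * snd z\<bar> < l \<longleftrightarrow> \<bar>snd z\<bar> < w" "\<bar>w / l * fst z\<bar> < w \<longleftrightarrow> \<bar>fst z\<bar> < l"
    using assms by (auto simp: abs_mult field_simps)
  moreover have "w / l * \<bar>l / w * snd z\<bar> = \<bar>snd z\<bar>" "\<bar>w / l * fst z\<bar> = w / l * \<bar>fst z\<bar>"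
    using assms by (auto simp: abs_mult)
  ultimately show ?thesis
    by (auto simp: overlap_rate_def aspect_swap_def)
qed

text \<open>With \<open>k = w / l < 1\<close>, the difference of the squared norms factors as
  \<open>(1 / k\<^sup>2 - 1) * ((k * s)\<^sup>2 - t\<^sup>2)\<close>, and both factors are
  positive.\<close>

lemma norm_aspect_swap_less:
  assumes "0 < w" "w < l" "\<bar>snd z\<bar> < w / l * \<bar>fst z\<bar>"
  shows "norm (aspect_swap l w z) < norm z"
proof -
  define s t k where "s = fst z" and "t = snd z" and "k = w / l"
  have k: "0 < k" "k < 1" using assms by (auto simp: k_def)
  have "\<bar>t\<bar> < \<bar>k * s\<bar>" using assms k by (simp add: s_def t_def k_def abs_mult)
  then have "t\<^sup>2 < (k * s)\<^sup>2" by (simp add: not_le[symmetric] abs_le_square_iff)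
  moreover have "1 < 1 / k\<^sup>2" using k by (simp add: power_less_one_iff)
  ultimately have "0 < (1 / k\<^sup>2 - 1) * ((k * s)\<^sup>2 - t\<^sup>2)" by simp
  also have "\<dots> = (s\<^sup>2 + t\<^sup>2) - ((1 / k * t)\<^sup>2 + (k * s)\<^sup>2)"
    using k by (simp add: field_simps)
  finally have "(1 / k * t)\<^sup>2 + (k * s)\<^sup>2 < s\<^sup>2 + t\<^sup>2" by simp
  then show ?thesis
    by (simp add: norm_prod_def aspect_swap_def s_def t_def k_def power_divide)
qed

lemma aspect_swap_aspect_swap: "0 < l \<Longrightarrow> 0 < w \<Longrightarrow> aspect_swap l w (aspect_swap l w z) = z"
  by (simp add: aspect_swap_def)

text \<open>Both factors change sign under the swap, so a positive rate may be assumed. Then the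
  swap shortens \<open>z\<close> and \<open>K\<close> increases.\<close>

lemma overlap_rate_pairing_neg:
  assumes lw: "0 < w" "w < l" and mono: "strict_antimono_on {0<..} K"
    and rate: "overlap_rate l w z \<noteq> 0"
  shows "overlap_rate l w z * (K (norm z) - K (norm (aspect_swap l w z))) < 0"
proof -
  have "0 < l" using lw by simp
  have pos: "overlap_rate l w z * (K (norm z) - K (norm (aspect_swap l w z))) < 0"
    if "0 < overlap_rate l w z" for z
  proof -
    have *: "\<bar>snd z\<bar> < w / l * \<bar>fst z\<bar>"
      using that by (auto simp: overlap_rate_def split: if_splits)
    then have "fst z \<noteq> 0" by auto
    \<comment> \<open>\<open>K\<close> is strictly decreasing only on the positive reals, so neither
      norm may be 0.\<close>
    then have "z \<noteq> 0" "aspect_swap l w z \<noteq> 0"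
      using lw by (auto simp: aspect_swap_def prod_eq_iff)
    then have "K (norm z) < K (norm (aspect_swap l w z))"
      using norm_aspect_swap_less[OF lw *] by (intro monotone_onD[OF mono]) auto
    with that show ?thesis by (simp add: mult_pos_neg)
  qed
  show ?thesis
  proof (cases "0 < overlap_rate l w z")
    case False
    then have "0 < overlap_rate l w (aspect_swap l w z)"
      using rate lw \<open>0 < l\<close> by (simp add: overlap_rate_aspect_swap)
    from pos[OF this] show ?thesis
      using lw \<open>0 < l\<close> by (simp add: overlap_rate_aspect_swap aspect_swap_aspect_swap algebra_simps)
  qed (rule pos)
qed

text \<open>Invariance of the measure under the swap makes twice the integral equal to that of the
  paired integrand \<open>?g\<close>, which is nowhere positive.\<close>

lemma integral_overlap_rate_neg:
  assumes lw: "0 < w" "w < l" and mono: "strict_antimono_on {0<..} K"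
    and [measurable]: "K \<in> borel_measurable borel"
    and int: "set_integrable lborel (cbox (- l, - w) (l, w)) (\<lambda>z. K (norm z))"
  shows "(\<integral>z. overlap_rate l w z * K (norm z) \<partial>lborel) < 0"
proof -
  have "0 < l" using lw by simp
  let ?f = "\<lambda>z. overlap_rate l w z * K (norm z)"
  let ?g = "\<lambda>z. overlap_rate l w z * (K (norm z) - K (norm (aspect_swap l w z)))"
  have f: "integrable lborel ?f"
  proof (rule Bochner_Integration.integrable_bound)
    show "integrable lborel (\<lambda>z. w * (indicator (cbox (- l, - w) (l, w)) z * K (norm z)))"
      using int by (simp add: set_integrable_def)
    have "\<bar>?f z\<bar> \<le> \<bar>w * (indicator (cbox (- l, - w) (l, w)) z * K (norm z))\<bar>" for z
    proof (cases "overlap_rate l w z = 0")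
      case False
      then have "z \<in> cbox (- l, - w) (l, w)"
        by (cases z) (auto simp: overlap_rate_def split: if_splits)
      then show ?thesis
        using abs_overlap_rate_le[OF \<open>0 < l\<close> lw(1), of z] lw by (simp add: abs_mult mult_right_mono)
    qed simp
    then show "AE z in lborel. norm (?f z) \<le> norm (w * (indicator (cbox (- l, - w) (l, w)) z * K (norm z)))"
      by simp
  qed measurable
  have distr: "distr lborel borel (aspect_swap l w) = lborel"
    using \<open>0 < l\<close> lw(1) by (rule distr_lborel_aspect_swap)
  have sum: "?f z + ?f (aspect_swap l w z) = ?g z" for z
    unfolding overlap_rate_aspect_swap[OF \<open>0 < l\<close> lw(1)] by (simp add: algebra_simps)
  have f': "integrable lborel (\<lambda>z. ?f (aspect_swap l w z))"
    by (rule integrable_distr[where M'=borel]) (simp_all add: distr f)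
  have "(\<integral>z. ?f z \<partial>lborel) = (\<integral>z. ?f (aspect_swap l w z) \<partial>lborel)"
    using integral_distr[of "aspect_swap l w" lborel borel ?f] by (simp add: distr)
  then have "2 * (\<integral>z. ?f z \<partial>lborel) = (\<integral>z. ?f z + ?f (aspect_swap l w z) \<partial>lborel)"
    using f f' by (subst Bochner_Integration.integral_add) auto
  also have "\<dots> = (\<integral>z. ?g z \<partial>lborel)"
    unfolding sum ..
  also have "\<dots> < 0"
  proof (rule integral_neg)
    show "integrable lborel ?g"
      using Bochner_Integration.integrable_add[OF f f'] unfolding sum .
    show "AE z in lborel. ?g z \<le> 0"
    proof (rule AE_I2)
      fix z show "?g z \<le> 0"
        using overlap_rate_pairing_neg[OF lw mono, of z] by (cases "overlap_rate l w z = 0") auto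
    qed
    \<comment> \<open>A set of positive area on which the rate does not vanish: there
      \<open>w / l * fst z > w / 2 > snd z\<close>.\<close>
    let ?A = "box (l / 2, 0) (l, w / 2)"
    show "?A \<in> sets lborel" by simp
    show "emeasure lborel ?A \<noteq> 0"
      using lw by (simp add: emeasure_lborel_box_pair)
    fix z :: "real \<times> real" assume "z \<in> ?A"
    then have z: "l / 2 < fst z" "fst z < l" "0 < snd z" "snd z < w / 2"
      by (auto simp: mem_box(1) Basis_prod_def inner_prod_def)
    then have "w / l * (l / 2) < w / l * fst z"
      using lw by (intro mult_strict_left_mono) auto
    moreover have "w / l * (l / 2) = w / 2"
      using lw by simp
    ultimately have "snd z < w / l * fst z"
      using z by linarith
    moreover have "overlap_rate l w z = w / l * fst z - snd z"
      using z lw by (simp add: overlap_rate_def)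
    ultimately have "overlap_rate l w z \<noteq> 0"
      by simp
    then show "?g z < 0"
      by (rule overlap_rate_pairing_neg[OF lw mono])
  qed
  finally show ?thesis by simp
qed

section \<open>Comparison of two energies at equal area\<close>

lemma integral_overlap_less:
  assumes m: "0 < m" and a: "0 < a" "m \<le> a\<^sup>2" and ab: "a < b"
    and mono: "strict_antimono_on {0<..} K"
    and [measurable]: "K \<in> borel_measurable borel"
    and int: "\<And>c d :: real \<times> real. set_integrable lborel (cbox c d) (\<lambda>z. K (norm z))"
  shows "(\<integral>z. overlap b (m / b) z * K (norm z) \<partial>lborel) < (\<integral>z. overlap a (m / a) z * K (norm z) \<partial>lborel)"
proof -
  have "0 < b" using a ab by simp
  \<comment> \<open>Contains the support of the rate for every \<open>x\<close> in
    \<open>{a..b}\<close>: the length is at most \<open>b\<close>, the width at most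
    \<open>m / a\<close>.\<close>
  let ?B = "cbox (- b, - (m / a)) (b, m / a)"
  let ?I = "indicator {a..b} :: real \<Rightarrow> real"
  let ?f = "\<lambda>x z. ?I x * (overlap_rate x (m / x) z * K (norm z))"
  have overlap: "integrable lborel (\<lambda>z. overlap l w z * K (norm z))" if "0 < l" "0 < w" for l w
  proof (rule Bochner_Integration.integrable_bound)
    show "integrable lborel (\<lambda>z. l * w * (indicator (cbox (- l, - w) (l, w)) z * K (norm z)))"
      using int by (simp add: set_integrable_def)
    have "\<bar>overlap l w z\<bar> \<le> l * w * indicator (cbox (- l, - w) (l, w)) z" for z
      using that by (cases z) (auto simp: overlap_def indicator_def abs_mult max_def abs_le_iff intro!: mult_mono)
    then have "\<bar>overlap l w z * K (norm z)\<bar> \<le> \<bar>l * w * (indicator (cbox (- l, - w) (l, w)) z * K (norm z))\<bar>" for z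
      using that by (simp add: abs_mult mult_right_mono flip: mult.assoc)
    then show "AE z in lborel. norm (overlap l w z * K (norm z))
        \<le> norm (l * w * (indicator (cbox (- l, - w) (l, w)) z * K (norm z)))"
      by simp
    have "(\<lambda>z. overlap l w z) \<in> borel_measurable borel"
      unfolding overlap_def by (intro borel_measurable_continuous_onI continuous_intros)
    then show "(\<lambda>z. overlap l w z * K (norm z)) \<in> borel_measurable lborel"
      by simp
  qed
  have I: "integrable lborel (\<lambda>x. m / a * ?I x)"
    using ab by (intro integrable_mult_right integrable_real_indicator) simp_all
  have ftc: "(\<integral>x. ?f x z \<partial>lborel) = (overlap b (m / b) z - overlap a (m / a) z) * K (norm z)" for z
  proof -
    \<comment> \<open>Boundedness by \<open>m / a\<close> gives Lebesgue integrability, so the gauge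
      integral from \<open>has_integral_overlap_rate\<close> is also the Lebesgue integral.\<close>
    have "set_integrable lborel {a..b} (\<lambda>x. overlap_rate x (m / x) z)"
      unfolding set_integrable_def
    proof (rule Bochner_Integration.integrable_bound)
      show "integrable lborel (\<lambda>x. m / a * ?I x)" by (rule I)
      have "\<bar>?I x * overlap_rate x (m / x) z\<bar> \<le> m / a * ?I x" for x
      proof (cases "x \<in> {a..b}")
        case True
        then have "\<bar>overlap_rate x (m / x) z\<bar> \<le> m / x"
          using m a by (intro abs_overlap_rate_le) auto
        also have "\<dots> \<le> m / a" using True m a by (intro divide_left_mono) auto
        finally show ?thesis using True by simp
      qed simp
      then show "AE x in lborel. norm (?I x *\<^sub>R overlap_rate x (m / x) z) \<le> norm (m / a * ?I x)"
        using m a by simp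
    qed measurable
    then have "(LINT x:{a..b}|lborel. overlap_rate x (m / x) z) = overlap b (m / b) z - overlap a (m / a) z"
      using has_integral_overlap_rate[OF m a(1), of b z] ab
      by (simp add: set_borel_integral_eq_integral(2) integral_unique)
    then show ?thesis
      by (simp add: set_lebesgue_integral_def flip: mult.assoc)
  qed
  have joint: "integrable (lborel \<Otimes>\<^sub>M lborel) (\<lambda>(x, z). ?f x z)"
  proof (rule Bochner_Integration.integrable_bound)
    show "integrable (lborel \<Otimes>\<^sub>M lborel) (\<lambda>(x, z). (m / a * ?I x) * (indicator ?B z * K (norm z)))"
      using int[of "(- b, - (m / a))" "(b, m / a)"]
      by (intro lborel_pair.integrable_product_mult I) (simp add: set_integrable_def)
    have "\<bar>?f x z\<bar> \<le> \<bar>(m / a * ?I x) * (indicator ?B z * K (norm z))\<bar>" for x z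
    proof (cases "x \<in> {a..b} \<and> overlap_rate x (m / x) z \<noteq> 0")
      case True
      then have x: "0 < x" "x \<le> b" "m / x \<le> m / a"
        using m a by (auto intro!: divide_left_mono)
      then have "z \<in> ?B"
        using True by (cases z) (auto simp: overlap_rate_def split: if_splits)
      moreover have "\<bar>overlap_rate x (m / x) z\<bar> \<le> m / a"
        using abs_overlap_rate_le[of x "m / x" z] x m by simp
      then have "\<bar>overlap_rate x (m / x) z\<bar> * \<bar>K (norm z)\<bar> \<le> m / a * \<bar>K (norm z)\<bar>"
        by (rule mult_right_mono) simp
      ultimately show ?thesis
        using True m a by (simp add: abs_mult)
    qed auto
    then show "AE p in lborel \<Otimes>\<^sub>M lborel. norm (case p of (x, z) \<Rightarrow> ?f x z)
        \<le> norm (case p of (x, z) \<Rightarrow> (m / a * ?I x) * (indicator ?B z * K (norm z)))"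
      by (simp add: case_prod_unfold)
  qed measurable
  have "(\<integral>z. overlap b (m / b) z * K (norm z) \<partial>lborel) - (\<integral>z. overlap a (m / a) z * K (norm z) \<partial>lborel)
      = (\<integral>z. \<integral>x. ?f x z \<partial>lborel \<partial>lborel)"
    using m a \<open>0 < b\<close> by (simp add: ftc left_diff_distrib overlap)
  also have "\<dots> = (\<integral>x. \<integral>z. ?f x z \<partial>lborel \<partial>lborel)"
    by (rule lborel_pair.Fubini_integral[OF joint])
  also have "\<dots> < 0"
  proof (rule integral_neg)
    show "integrable lborel (\<lambda>x. \<integral>z. ?f x z \<partial>lborel)"
      by (rule lborel_pair.integrable_fst[OF joint])
    have neg: "(\<integral>z. ?f x z \<partial>lborel) < 0" if "a < x" "x \<le> b" for x
    proof -
      \<comment> \<open>Together with \<open>m \<le> a\<^sup>2\<close> this makes \<open>x\<close>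
        strictly the longer side, as the sign lemma requires.\<close>
      have "a * a < x * x" using that a by (intro mult_strict_mono) auto
      then have "m / x < x"
        using that a by (simp add: field_simps power2_eq_square)
      then have "(\<integral>z. overlap_rate x (m / x) z * K (norm z) \<partial>lborel) < 0"
        using that a m by (intro integral_overlap_rate_neg mono int) auto
      then show ?thesis using that by simp
    qed
    \<comment> \<open>The endpoint \<open>a\<close> is discarded as a null set:
      \<open>m = a\<^sup>2\<close> is allowed, and for that square the strict inequality of the
      sides fails.\<close>
    show "AE x in lborel. (\<integral>z. ?f x z \<partial>lborel) \<le> 0"
      using AE_lborel_singleton[of a]
    proof eventually_elim
      case (elim x)
      then show ?case
        using neg[of x] by (cases "x \<in> {a..b}") auto
    qed
    show "{a<..<b} \<in> sets lborel" "emeasure lborel {a<..<b} \<noteq> 0"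
      using ab by auto
    show "(\<integral>z. ?f x z \<partial>lborel) < 0" if "x \<in> {a<..<b}" for x
      using neg that by simp
  qed
  finally show ?thesis by simp
qed

section \<open>Return to rectangles in the plane\<close>

lemma rectangle_eq_frame:
  "{c + s *\<^sub>R u + t *\<^sub>R v | s t. 0 \<le> s \<and> s \<le> l \<and> 0 \<le> t \<and> t \<le> w} = frame c u v ` cbox (0, 0) (l, w)"
  by (force simp: frame_def image_iff)

text \<open>The change of variables is applied to the constant 1; this turns the prescribed area
  into the relation \<open>m = l * w\<close>.\<close>

lemma measure_frame:
  assumes uv: "norm u = 1" "norm v = 1" "u \<bullet> v = 0" and lw: "0 < l" "0 < w"
  shows "measure lborel (frame c u v ` cbox (0, 0) (l, w)) = l * w"
proof -
  have "(LINT x:frame c u v ` cbox (0, 0) (l, w)|lborel. 1 :: real) = (LINT p:cbox (0, 0) (l, w)|lborel. 1)"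
    by (rule set_lebesgue_integral_frame[OF uv]) auto
  then show ?thesis
    using lw by (simp add: set_lebesgue_integral_def content_Pair)
qed

theorem theorem1p9:
  fixes K :: "real \<Rightarrow> real" and m :: real and R :: "real \<Rightarrow> (real^2) set"
  assumes "K C1_differentiable_on {0<..}"
    and "strict_antimono_on {0<..} K"
    and "set_integrable lborel {0<..1} (\<lambda>r. K r * r)"
    and "m > 0"
    and "\<And>q. q \<ge> 1 \<Longrightarrow> rectangle_of_area_and_ratio m q (R q)"
  shows "strict_antimono_on {1..} (\<lambda>q. double_integral K (R q))"
proof -
  \<comment> \<open>Nothing is known about K on the negative reals, so K itself need not be Borel measurable.\<close>
  define k where "k = (\<lambda>r. if 0 < r then K r else K 0)"
  have [measurable]: "k \<in> borel_measurable borel"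
  proof -
    have "continuous_on {0<..} K"
      using assms(1) by (rule C1_differentiable_imp_continuous_on)
    then have "(\<lambda>r. indicator {0<..} r *\<^sub>R K r) \<in> borel_measurable borel"
      by (intro borel_measurable_continuous_on_indicator) auto
    moreover have "k = (\<lambda>r. indicator {0<..} r *\<^sub>R K r + indicator {..0} r *\<^sub>R K 0)"
      by (auto simp: k_def indicator_def fun_eq_iff)
    ultimately show ?thesis by simp
  qed
  have mono: "strict_antimono_on {0<..} k"
    using assms(2) by (auto simp: k_def monotone_on_def)
  have "antimono_on {0<..} k"
    using mono by (auto simp: monotone_on_def le_less)
  moreover have "set_integrable lborel {0<..1} (\<lambda>r. k r * r)"
    using assms(3) by (rule set_integrable_cong[THEN iffD1, rotated 3]) (auto simp: k_def)
  ultimately have int: "set_integrable lborel (cbox a b) (\<lambda>z. k (norm z))" for a b :: "real \<times> real"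
    by (intro set_integrable_radial) auto
  \<comment> \<open>Area \<open>l * w = m\<close> and ratio \<open>l / w = q\<close> force
    \<open>l = sqrt (m * q)\<close>, so the energy depends on \<open>q\<close> alone and not on the
    position of \<open>R q\<close>.\<close>
  have double_integral: "double_integral K (R q)
      = (\<integral>z. overlap (sqrt (m * q)) (m / sqrt (m * q)) z * k (norm z) \<partial>lborel)" if q1: "1 \<le> q" for q
  proof -
    obtain l w c u v where lw: "0 < l" "0 < w" and q: "q = l / w"
      and uv: "norm u = 1" "norm v = 1" "u \<bullet> v = 0"
      and R: "R q = frame c u v ` cbox (0, 0) (l, w)" and "measure lborel (R q) = m"
      using assms(5)[OF q1]
      unfolding rectangle_of_area_and_ratio_def rectangle_def rectangle_eq_frame by metis
    then have m: "m = l * w" by (simp add: measure_frame)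
    have "m * q = l\<^sup>2" using lw by (simp add: m q power2_eq_square)
    then have "sqrt (m * q) = l" using lw by simp
    moreover have "m / l = w" using lw by (simp add: m)
    moreover have "double_integral K (R q) = double_integral k (R q)"
    proof -
      \<comment> \<open>Distances are nonnegative, and \<open>k\<close> keeps the value of
        \<open>K\<close> at 0.\<close>
      have "k (dist x y) = K (dist x y)" for x y :: "real^2"
        by (simp add: k_def)
      then show ?thesis by (simp add: double_integral_def)
    qed
    ultimately show ?thesis
      using double_integral_frame[OF uv lw _ int] by (simp add: R)
  qed
  show ?thesis
  proof (rule monotone_onI)
    fix p q :: real assume "p \<in> {1..}" "q \<in> {1..}" "p < q"
    then have pq: "1 \<le> p" "1 \<le> q" "p < q" by auto
    have "m * 1 \<le> m * p"
      using \<open>m > 0\<close> pq by (intro mult_left_mono) auto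
    then have "m \<le> (sqrt (m * p))\<^sup>2"
      using \<open>m > 0\<close> pq by simp
    then show "double_integral K (R p) > double_integral K (R q)"
      unfolding double_integral[OF pq(1)] double_integral[OF pq(2)]
      using \<open>m > 0\<close> pq by (intro integral_overlap_less mono int) auto
  qed
qed

end
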